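(* For every $n\geq0$, the space $R_q(n)$ of radial vectors is contained in the span of $\{v_\alpha:\alpha\in\{0,1\}^n\}$.
   Context: $q$ is a prime power. For $m\geq0$, $\mathbb{F}_q^m$ is the space of column vectors of length $m$ over $\mathbb{F}_q$; for $j<m$, $\mathbb{F}_q^j$ is identified with the subspace of $\mathbb{F}_q^m$ of vectors whose last $m-j$ coordinates vanish. $B_q(m)$ is the set of subspaces of $\mathbb{F}_q^m$ and $B_q(m,k)$ those of dimension $k$; $\mathbb{C}[B_q(m)]$ is the complex vector space with basis $B_q(m)$, and $\mathbb{C}[B_q(m)]\subseteq\mathbb{C}[B_q(m+1)]$. $R_q(n)$ is the subspace of $\mathbb{C}[B_q(n)]$ spanned by $s_k=\sum_{X\in B_q(n,k)}X$, $k=0,\dots,n$. $A_q(m+1)=\{Y\in B_q(m+1):Y\not\subseteq\mathbb{F}_q^m\}$, and $\theta_m:\mathbb{C}[B_q(m)]\to\mathbb{C}[B_q(m+1)]$ is linear with $\theta_m(Z)=\sum Y$ over $Y\in A_q(m+1)$ with $Y\cap\mathbb{F}_q^m=Z$. Define $v_{()}=\{0\}\in\mathbb{C}[B_q(0)]$, and for $m\geq0$, $\beta\in\{0,1\}^m$ with $k'$ entries equal to $1$: $v_{(\beta,0)}=q^{k'}v_\beta+\theta_m(v_\beta)$ and $v_{(\beta,1)}=q^{m-k'}v_\beta-\theta_m(v_\beta)$, where $(\beta,a)$ is $\beta$ with $a$ appended. Thus $v_\alpha\in\mathbb{C}[B_q(n)]$ for $\alpha\in\{0,1\}^n$. *)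

theory Defs
  imports Complex_Main "HOL-Library.Function_Algebras" "HOL-Library.Cardinality"
begin

text \<open>
  The field with \<open>q\<close> elements is a type \<open>'a\<close> of class \<open>field\<close> and \<open>finite\<close>, with \<open>q = CARD('a)\<close>.
  Column vectors are functions on \<open>nat\<close> that vanish from some index on, so that the
  identification of the space of dimension \<open>j\<close> with a subspace of the one of dimension
  \<open>m > j\<close> is an actual inclusion. Likewise the formal complex combinations of subspaces are
  complex-valued functions on sets of vectors, with support in \<open>Bq m\<close>. Both are vector spaces
  under the pointwise operations; addition is that of \<open>Function_Algebras\<close>.
\<close>

definition fscale :: "'k::field \<Rightarrow> ('i \<Rightarrow> 'k) \<Rightarrow> 'i \<Rightarrow> 'k" (infixr "\<odot>" 75) where
  "c \<odot> f = (\<lambda>i. c * f i)"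

global_interpretation fs: vector_space "fscale :: 'k::field \<Rightarrow> ('i \<Rightarrow> 'k) \<Rightarrow> 'i \<Rightarrow> 'k"
  by unfold_locales (auto simp: fscale_def plus_fun_def algebra_simps)

definition Fq :: "nat \<Rightarrow> (nat \<Rightarrow> 'a::{field,finite}) set" where
  "Fq m = {x. \<forall>i\<ge>m. x i = 0}"

definition Bq :: "nat \<Rightarrow> (nat \<Rightarrow> 'a::{field,finite}) set set" where
  "Bq m = {X. fs.subspace X \<and> X \<subseteq> Fq m}"

definition Bqk :: "nat \<Rightarrow> nat \<Rightarrow> (nat \<Rightarrow> 'a::{field,finite}) set set" where
  "Bqk m k = {X \<in> Bq m. fs.dim X = k}"

text \<open>All sums below range over subsets of \<open>Bq m\<close>, hence over finite sets.\<close>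

lemma finite_Fq: "finite (Fq m :: (nat \<Rightarrow> 'a::{field,finite}) set)"
proof -
  have "Fq m = {x :: nat \<Rightarrow> 'a. \<forall>i. (i \<in> {..<m} \<longrightarrow> x i \<in> UNIV) \<and> (i \<notin> {..<m} \<longrightarrow> x i = 0)}"
    by (auto simp: Fq_def not_less)
  thus ?thesis
    using finite_set_of_finite_funs[of "{..<m}" "UNIV :: 'a set" 0] by simp
qed

lemma finite_Bq: "finite (Bq m :: (nat \<Rightarrow> 'a::{field,finite}) set set)"
  by (rule finite_subset[of _ "Pow (Fq m)"]) (auto simp: Bq_def finite_Fq)

definition basis_vec :: "(nat \<Rightarrow> 'a) set \<Rightarrow> (nat \<Rightarrow> 'a) set \<Rightarrow> complex" where
  "basis_vec X = (\<lambda>Y. if Y = X then 1 else 0)"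

definition s_vec :: "nat \<Rightarrow> nat \<Rightarrow> (nat \<Rightarrow> 'a::{field,finite}) set \<Rightarrow> complex" where
  "s_vec n k = (\<Sum>X\<in>Bqk n k. basis_vec X)"

definition Rq :: "nat \<Rightarrow> ((nat \<Rightarrow> 'a::{field,finite}) set \<Rightarrow> complex) set" where
  "Rq n = fs.span {s_vec n k | k. k \<le> n}"

text \<open>Only used for \<open>m \<ge> 1\<close>.\<close>

definition Aq :: "nat \<Rightarrow> (nat \<Rightarrow> 'a::{field,finite}) set set" where
  "Aq m = {Y \<in> Bq m. \<not> Y \<subseteq> Fq (m - 1)}"

text \<open>The linear extension of its values on the basis vectors \<open>basis_vec Z\<close>, \<open>Z \<in> Bq m\<close>;
  coordinates of \<open>f\<close> outside \<open>Bq m\<close> are ignored.\<close>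

definition theta ::
  "nat \<Rightarrow> ((nat \<Rightarrow> 'a::{field,finite}) set \<Rightarrow> complex) \<Rightarrow> (nat \<Rightarrow> 'a) set \<Rightarrow> complex" where
  "theta m f = (\<Sum>Z\<in>Bq m. f Z \<odot> (\<Sum>Y | Y \<in> Aq (Suc m) \<and> Y \<inter> Fq m = Z. basis_vec Y))"

text \<open>A word in \<open>{0,1}\<close> is a list of Booleans, with \<open>True\<close> for \<open>1\<close>; the length \<open>m\<close> is that of
  the list.\<close>

function v_vec :: "bool list \<Rightarrow> (nat \<Rightarrow> 'a::{field,finite}) set \<Rightarrow> complex" where
  "v_vec [] = basis_vec {0}"
| "v_vec (\<beta> @ [False]) =
     of_nat CARD('a) ^ count_list \<beta> True \<odot> v_vec \<beta> + theta (length \<beta>) (v_vec \<beta>)"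
| "v_vec (\<beta> @ [True]) =
     of_nat CARD('a) ^ (length \<beta> - count_list \<beta> True) \<odot> v_vec \<beta> - theta (length \<beta>) (v_vec \<beta>)"
proof -
  fix P and x :: "bool list"
  assume "x = [] \<Longrightarrow> P" "\<And>\<beta>. x = \<beta> @ [False] \<Longrightarrow> P" "\<And>\<beta>. x = \<beta> @ [True] \<Longrightarrow> P"
  thus P by (cases x rule: rev_cases) (metis (full_types))+
qed auto
termination by (relation "measure length") auto

end

theory Submission
  imports Defs
begin

text \<open>
  Radial vectors satisfy the \<open>q\<close>-Pascal recursion \<open>s_{m+1,k} = s_{m,k} + \<theta>_m(s_{m,k-1})\<close>, because
  \<open>Y \<inter> Fq m\<close> is a hyperplane of \<open>Y\<close> for every \<open>Y \<in> Aq (m + 1)\<close>. On the other hand the span of the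
  \<open>v_\<alpha>\<close> of level \<open>m + 1\<close> contains both \<open>v_\<beta>\<close> and \<open>\<theta>_m(v_\<beta>)\<close> for every \<open>\<beta>\<close> of length \<open>m\<close>: the two
  children of \<open>v_\<beta>\<close> add up to \<open>q^{k'} + q^{m-k'} \<noteq> 0\<close> times \<open>v_\<beta>\<close>. Induction on \<open>n\<close> concludes.
\<close>

lemma sum_fun_apply: "(\<Sum>i\<in>A. f i) x = (\<Sum>i\<in>A. f i x)"
  for f :: "'i \<Rightarrow> 'b \<Rightarrow> 'c::comm_monoid_add"
  by (induction A rule: infinite_finite_induct) (auto simp: plus_fun_def)

lemma subspace_Fq: "fs.subspace (Fq m :: (nat \<Rightarrow> 'a::{field,finite}) set)"
  by (auto simp: fs.subspace_def Fq_def fscale_def plus_fun_def)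

lemma Bq_Suc: "(Y :: (nat \<Rightarrow> 'a::{field,finite}) set) \<in> Bq (Suc m) \<longleftrightarrow> Y \<in> Bq m \<or> Y \<in> Aq (Suc m)"
  by (fastforce simp: Bq_def Aq_def Fq_def)

lemma Aq_Suc_Int_Fq:
  assumes "(Y :: (nat \<Rightarrow> 'a::{field,finite}) set) \<in> Aq (Suc m)"
  shows "Y \<inter> Fq m \<in> Bq m"
  using assms by (auto simp: Bq_def Aq_def intro: fs.subspace_inter subspace_Fq)

text \<open>Only coordinate \<open>m\<close> separates \<open>Fq (Suc m)\<close> from
  \<open>Fq m\<close>, so a basis of \<open>Y \<inter> Fq m\<close> together with any
  \<open>y\<close> in \<open>Y\<close> outside \<open>Fq m\<close> is a basis of
  \<open>Y\<close>.\<close>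

lemma dim_Aq_Suc:
  fixes Y :: "(nat \<Rightarrow> 'a::{field,finite}) set"
  assumes "Y \<in> Aq (Suc m)"
  shows "fs.dim Y = Suc (fs.dim (Y \<inter> Fq m))"
proof -
  define Z where "Z = Y \<inter> Fq m"
  have Y: "fs.subspace Y" "Y \<subseteq> Fq (Suc m)" "\<not> Y \<subseteq> Fq m"
    using assms by (auto simp: Aq_def Bq_def)
  have Z: "fs.subspace Z"
    using Y(1) by (auto simp: Z_def intro: fs.subspace_inter subspace_Fq)
  obtain B where B: "B \<subseteq> Z" "fs.independent B" "Z \<subseteq> fs.span B" "card B = fs.dim Z"
    by (rule fs.basis_exists)
  have span_B: "fs.span B = Z"
    using B(1,3) Z by (metis fs.span_minimal subset_antisym)
  have "finite B"
    using B(1) finite_Fq[of m] by (auto simp: Z_def intro: finite_subset)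
  obtain y where y: "y \<in> Y" "y \<notin> Fq m"
    using Y(3) by blast
  have y_m: "y m \<noteq> 0"
  proof
    assume "y m = 0"
    hence "y i = 0" if "i \<ge> m" for i
      using that y(1) Y(2) by (cases "i = m") (auto simp: Fq_def)
    thus False
      using y(2) by (auto simp: Fq_def)
  qed
  have "y \<notin> Z"
    using y by (simp add: Z_def)
  hence indep: "fs.independent (insert y B)" and "y \<notin> B"
    using B(1,2) span_B by (auto simp: fs.independent_insert)
  have "fs.span (insert y B) = Y"
  proof
    show "fs.span (insert y B) \<subseteq> Y"
      using B(1) y(1) Y(1) by (intro fs.span_minimal) (auto simp: Z_def)
  next
    show "Y \<subseteq> fs.span (insert y B)"
    proof
      fix x assume x: "x \<in> Y"
      \<comment> \<open>The coefficient cancels coordinate \<open>m\<close>, which moves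
        \<open>x\<close> into \<open>Y \<inter> Fq m\<close>.\<close>
      let ?z = "x - (x m / y m) \<odot> y"
      have "?z \<in> Y"
        using x y(1) Y(1) by (intro fs.subspace_diff fs.subspace_scale)
      moreover have "?z i = 0" if "i \<ge> m" for i
      proof (cases "i = m")
        case True
        thus ?thesis using y_m by (simp add: fscale_def)
      next
        case False
        hence "x i = 0" "y i = 0"
          using that x y(1) Y(2) by (auto simp: Fq_def)
        thus ?thesis by (simp add: fscale_def)
      qed
      ultimately have "?z \<in> fs.span B"
        unfolding span_B Z_def Fq_def by blast
      thus "x \<in> fs.span (insert y B)"
        unfolding fs.span_insert by blast
    qed
  qed
  hence "fs.dim Y = card (insert y B)"
    using indep by (metis fs.dim_eq_card fs.span_span)
  thus ?thesis
    using \<open>finite B\<close> \<open>y \<notin> B\<close> B(4) by (simp add: Z_def)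
qed

lemma s_vec_apply:
  "s_vec n k Y = (if (Y :: (nat \<Rightarrow> 'a::{field,finite}) set) \<in> Bqk n k then 1 else 0)"
proof -
  have "finite (Bqk n k :: (nat \<Rightarrow> 'a) set set)"
    by (rule finite_subset[OF _ finite_Bq[of n]]) (auto simp: Bqk_def)
  thus ?thesis
    by (simp add: s_vec_def sum_fun_apply basis_vec_def)
qed

text \<open>A subspace \<open>Y\<close> in \<open>Aq (Suc m)\<close> occurs only in the image of the
  basis vector of its trace \<open>Y \<inter> Fq m\<close>, so a single coordinate of
  \<open>f\<close> contributes. Identities about \<open>theta\<close> thereby become pointwise
  checks.\<close>

lemma theta_apply:
  fixes Y :: "(nat \<Rightarrow> 'a::{field,finite}) set"
  shows "theta m f Y = (if Y \<in> Aq (Suc m) then f (Y \<inter> Fq m) else 0)"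
proof -
  have fin: "finite {Y :: (nat \<Rightarrow> 'a) set. Y \<in> Aq (Suc m) \<and> Y \<inter> Fq m = Z}" for Z
    by (rule finite_subset[OF _ finite_Bq[of "Suc m"]]) (auto simp: Aq_def)
  have "theta m f Y = (\<Sum>Z\<in>Bq m. if Y \<inter> Fq m = Z then if Y \<in> Aq (Suc m) then f Z else 0 else 0)"
    using fin by (auto simp: theta_def sum_fun_apply fscale_def basis_vec_def intro!: sum.cong)
  \<comment> \<open>The trace belongs to the index set \<open>Bq m\<close>, so the sum picks it
    up.\<close>
  also have "\<dots> = (if Y \<in> Aq (Suc m) then f (Y \<inter> Fq m) else 0)"
    using Aq_Suc_Int_Fq[of Y m] by (simp add: finite_Bq)
  finally show ?thesis .
qed

lemma theta_linear:
  "theta m (0 :: (nat \<Rightarrow> 'a::{field,finite}) set \<Rightarrow> complex) = 0"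
  "theta m (f + g) = theta m f + theta m (g :: (nat \<Rightarrow> 'a) set \<Rightarrow> complex)"
  "theta m (c \<odot> f) = c \<odot> theta m f"
  by (auto simp: fun_eq_iff theta_apply fscale_def)

text \<open>Boundary case of the recursion: every member of \<open>Aq (Suc m)\<close> has positive
  dimension.\<close>

lemma s_vec_Suc_0:
  "s_vec (Suc m) 0 = (s_vec m 0 :: (nat \<Rightarrow> 'a::{field,finite}) set \<Rightarrow> complex)"
proof
  fix Y :: "(nat \<Rightarrow> 'a) set"
  show "s_vec (Suc m) 0 Y = s_vec m 0 Y"
    using dim_Aq_Suc[of Y m] by (auto simp: s_vec_apply Bqk_def Bq_Suc)
qed

text \<open>By \<open>dim_Aq_Suc\<close>, the new subspaces of dimension \<open>Suc k\<close> are
  those whose trace has dimension \<open>k\<close>. No power of \<open>q\<close> appears because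
  \<open>theta\<close> already sums over all \<open>Y\<close> with a given trace.\<close>

lemma s_vec_Suc_Suc:
  "s_vec (Suc m) (Suc k) =
     s_vec m (Suc k) + theta m (s_vec m k :: (nat \<Rightarrow> 'a::{field,finite}) set \<Rightarrow> complex)"
proof
  fix Y :: "(nat \<Rightarrow> 'a) set"
  \<comment> \<open>Old and new subspaces are disjoint, so at most one summand is nonzero at
    \<open>Y\<close>.\<close>
  have "Y \<notin> Bq m" if "Y \<in> Aq (Suc m)"
    using that by (auto simp: Aq_def Bq_def)
  thus "s_vec (Suc m) (Suc k) Y = (s_vec m (Suc k) + theta m (s_vec m k)) Y"
    using dim_Aq_Suc[of Y m] Aq_Suc_Int_Fq[of Y m]
    by (auto simp: s_vec_apply theta_apply Bqk_def Bq_Suc)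
qed

context
  fixes V :: "nat \<Rightarrow> ((nat \<Rightarrow> 'a::{field,finite}) set \<Rightarrow> complex) set"
  defines "V \<equiv> \<lambda>n. fs.span (v_vec ` {\<alpha>. length \<alpha> = n})"
begin

lemma v_vec_in_span: "v_vec \<alpha> \<in> V (length \<alpha>)"
  unfolding V_def by (intro fs.span_base) auto

lemma v_vec_in_span_Suc:
  assumes "length \<beta> = m"
  shows "v_vec \<beta> \<in> V (Suc m)" and "theta m (v_vec \<beta>) \<in> V (Suc m)"
proof -
  define a :: complex where "a = of_nat CARD('a) ^ count_list \<beta> True"
  define b :: complex where "b = of_nat CARD('a) ^ (length \<beta> - count_list \<beta> True)"
  let ?v = "v_vec \<beta> :: (nat \<Rightarrow> 'a) set \<Rightarrow> complex"
  have 0: "a \<odot> ?v + theta m ?v \<in> V (Suc m)" and 1: "b \<odot> ?v - theta m ?v \<in> V (Suc m)"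
    using assms v_vec_in_span[of "\<beta> @ [False]"] v_vec_in_span[of "\<beta> @ [True]"]
    by (simp_all add: a_def b_def)
  \<comment> \<open>As the cast of a positive natural number, the sum is nonzero in the complex
    numbers.\<close>
  have "a + b = of_nat (CARD('a) ^ count_list \<beta> True
                  + CARD('a) ^ (length \<beta> - count_list \<beta> True))"
    by (simp add: a_def b_def)
  hence "a + b \<noteq> 0"
    by (simp only: of_nat_eq_0_iff) simp
  hence "?v = (1 / (a + b)) \<odot> ((a \<odot> ?v + theta m ?v) + (b \<odot> ?v - theta m ?v))"
    by (auto simp: fun_eq_iff fscale_def field_simps)
  also have "\<dots> \<in> V (Suc m)"
    using 0 1 unfolding V_def by (rule fs.span_scale[OF fs.span_add])
  finally show v: "?v \<in> V (Suc m)" .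
  have "(a \<odot> ?v + theta m ?v) - a \<odot> ?v \<in> V (Suc m)"
    using 0 v unfolding V_def by (rule fs.span_diff[OF _ fs.span_scale])
  thus "theta m ?v \<in> V (Suc m)"
    by simp
qed

lemma span_subset_span_Suc: "V m \<subseteq> V (Suc m)"
  using v_vec_in_span_Suc(1) unfolding V_def by (intro fs.span_minimal) auto

text \<open>The preimage of a subspace under the linear map \<open>theta m\<close> is a subspace, so
  checking the generators \<open>v_vec \<beta>\<close> suffices.\<close>

lemma theta_in_span_Suc:
  assumes "f \<in> V m"
  shows "theta m f \<in> V (Suc m)"
proof -
  have "fs.subspace {f. theta m f \<in> V (Suc m)}"
    unfolding V_def
    by (auto simp: fs.subspace_def theta_linear fs.span_zero intro: fs.span_add fs.span_scale)
  hence "V m \<subseteq> {f. theta m f \<in> V (Suc m)}"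
    unfolding V_def using v_vec_in_span_Suc(2)
    by (intro fs.span_minimal) (auto simp: V_def)
  thus ?thesis
    using assms by blast
qed

text \<open>Here \<open>k\<close> may exceed \<open>n\<close>, where \<open>s_vec n k\<close> is an
  empty sum; the step for \<open>k = Suc m\<close> meets this case in
  \<open>s_vec m (Suc m)\<close>.\<close>

lemma s_vec_in_span: "s_vec n k \<in> V n"
proof (induction n arbitrary: k)
  case 0
  have "Bq 0 = {{0 :: nat \<Rightarrow> 'a}}"
    using fs.subspace_0 by (fastforce simp: Bq_def Fq_def fun_eq_iff)
  moreover have "fs.dim {0 :: nat \<Rightarrow> 'a} = 0"
    using fs.dim_eq_card[of "{}" "{0 :: nat \<Rightarrow> 'a}"] by (simp add: fs.independent_empty)
  \<comment> \<open>The zero space is the only subspace at level 0, and its dimension is 0.\<close>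
  ultimately have "s_vec 0 k = (if k = 0 then v_vec [] else (0 :: (nat \<Rightarrow> 'a) set \<Rightarrow> complex))"
    by (auto simp: fun_eq_iff s_vec_apply Bqk_def basis_vec_def)
  thus ?case
    using v_vec_in_span[of "[]"] fs.span_zero by (auto simp: V_def)
next
  case (Suc m)
  show ?case
  proof (cases k)
    case 0
    thus ?thesis
      using Suc.IH span_subset_span_Suc by (auto simp: s_vec_Suc_0)
  next
    case k: (Suc k')
    have "s_vec m k \<in> V (Suc m)" "theta m (s_vec m k') \<in> V (Suc m)"
      using Suc.IH span_subset_span_Suc theta_in_span_Suc by auto
    thus ?thesis
      unfolding k s_vec_Suc_Suc V_def by (rule fs.span_add)
  qed
qed

end

theorem theorem4p7:
  fixes n :: nat
  shows "(Rq n :: ((nat \<Rightarrow> 'a::{field,finite}) set \<Rightarrow> complex) set)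
           \<subseteq> fs.span (v_vec ` {\<alpha>. length \<alpha> = n})"
  unfolding Rq_def using s_vec_in_span by (intro fs.span_minimal) auto

end
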